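(* Let $\pi$ be a finite projective plane of order $q^2$ and let $\perp$ be a unitary polarity of $\pi$. Let $S$ be a set of non-absolute points of $\pi$ such that the subgraph of the unitary polarity graph $\mathrm{UP}(q^2)$ induced on $S$ contains no triangle. Then \[|S| \leq \frac{q^4+q}{2}.\] Moreover, if equality holds and $\ell$ is any line of $\pi$, then $|\ell \cap S| \in \{\frac{q^2-q}{2}, \frac{q^2+q}{2}\}$.
   Context: A polarity $\perp$ of a projective plane is an involutory bijection sending points to lines and lines to points which preserves incidence; $x^\perp$ is the polar line of the point $x$. A point $x$ is absolute if $x \in x^\perp$. A unitary polarity of a projective plane of order $q^2$ is a polarity with exactly $q^3+1$ absolute points. The unitary polarity graph $\mathrm{UP}(q^2)$ is the graph whose vertices are the points of $\pi$, two vertices $x,y$ being adjacent iff $x \in y^\perp$ (absolute points carry loops). A triangle is a set of three distinct pairwise adjacent vertices. *)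

theory Defs
  imports Complex_Main "Graph_Theory.Digraph_Component"
begin

text \<open>A line is identified with the set of points incident with it.\<close>

definition projective_plane :: "'p set \<Rightarrow> 'p set set \<Rightarrow> bool" where
  "projective_plane P L \<longleftrightarrow>
     (\<forall>l\<in>L. l \<subseteq> P) \<and>
     (\<forall>x\<in>P. \<forall>y\<in>P. x \<noteq> y \<longrightarrow> (\<exists>!l. l \<in> L \<and> x \<in> l \<and> y \<in> l)) \<and>
     (\<forall>l\<in>L. \<forall>m\<in>L. l \<noteq> m \<longrightarrow> (\<exists>!x. x \<in> P \<and> x \<in> l \<and> x \<in> m)) \<and>
     (\<exists>Q. Q \<subseteq> P \<and> card Q = 4 \<and> (\<forall>l\<in>L. card (Q \<inter> l) \<le> 2))"

definition projective_plane_of_order :: "nat \<Rightarrow> 'p set \<Rightarrow> 'p set set \<Rightarrow> bool" where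
  "projective_plane_of_order n P L \<longleftrightarrow>
     projective_plane P L \<and> finite P \<and> (\<forall>l\<in>L. card l = n + 1)"

text \<open>
  A polarity is one involutory map on the disjoint union of points and lines that swaps the two
  kinds. It is given by its two restrictions: \<open>polar\<close> on points and \<open>pole\<close> on lines.
\<close>

definition polarity ::
    "'p set \<Rightarrow> 'p set set \<Rightarrow> ('p \<Rightarrow> 'p set) \<Rightarrow> ('p set \<Rightarrow> 'p) \<Rightarrow> bool" where
  "polarity P L polar pole \<longleftrightarrow>
     bij_betw polar P L \<and> bij_betw pole L P \<and>
     (\<forall>x\<in>P. pole (polar x) = x) \<and> (\<forall>l\<in>L. polar (pole l) = l) \<and>
     (\<forall>x\<in>P. \<forall>l\<in>L. x \<in> l \<longleftrightarrow> pole l \<in> polar x)"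

definition absolute_points :: "'p set \<Rightarrow> ('p \<Rightarrow> 'p set) \<Rightarrow> 'p set" where
  "absolute_points P polar = {x \<in> P. x \<in> polar x}"

definition unitary_polarity ::
    "nat \<Rightarrow> 'p set \<Rightarrow> 'p set set \<Rightarrow> ('p \<Rightarrow> 'p set) \<Rightarrow> ('p set \<Rightarrow> 'p) \<Rightarrow> bool" where
  "unitary_polarity q P L polar pole \<longleftrightarrow>
     projective_plane_of_order (q ^ 2) P L \<and> polarity P L polar pole \<and>
     card (absolute_points P polar) = q ^ 3 + 1"

text \<open>
  The polarity graph is undirected with loops; it is encoded as a digraph whose arc set is
  symmetric (lemma \<open>symmetric_polarity_graph\<close>), each edge being a pair of opposite arcs.
\<close>

definition polarity_graph :: "'p set \<Rightarrow> ('p \<Rightarrow> 'p set) \<Rightarrow> ('p, 'p \<times> 'p) pre_digraph" where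
  "polarity_graph P polar =
     \<lparr>verts = P, arcs = {(x, y). x \<in> P \<and> y \<in> P \<and> x \<in> polar y}, tail = fst, head = snd\<rparr>"

lemma dominates_polarity_graph:
  "x \<rightarrow>\<^bsub>polarity_graph P polar\<^esub> y \<longleftrightarrow> x \<in> P \<and> y \<in> P \<and> x \<in> polar y"
  by (auto simp: polarity_graph_def arcs_ends_def arc_to_ends_def)

lemma symmetric_polarity_graph:
  assumes "polarity P L polar pole"
  shows "symmetric (polarity_graph P polar)"
  unfolding symmetric_def
proof (rule symI)
  fix x y assume "x \<rightarrow>\<^bsub>polarity_graph P polar\<^esub> y"
  then have xy: "x \<in> P" "y \<in> P" "x \<in> polar y" by (auto simp: dominates_polarity_graph)
  with assms have "polar y \<in> L" by (auto simp: polarity_def bij_betw_def)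
  with assms xy have "pole (polar y) \<in> polar x" unfolding polarity_def by blast
  with assms xy have "y \<in> polar x" by (simp add: polarity_def)
  with xy show "y \<rightarrow>\<^bsub>polarity_graph P polar\<^esub> x" by (simp add: dominates_polarity_graph)
qed

definition is_triangle :: "('a, 'b) pre_digraph \<Rightarrow> 'a set \<Rightarrow> bool" where
  "is_triangle G T \<longleftrightarrow> T \<subseteq> verts G \<and> card T = 3 \<and> (\<forall>x\<in>T. \<forall>y\<in>T. x \<noteq> y \<longrightarrow> x \<rightarrow>\<^bsub>G\<^esub> y)"

end

theory Submission
  imports Defs
begin

text \<open>
  For a set \<open>T\<close> of points let \<open>d\<^sub>T x = |x\<^sup>\<bottom> \<inter> T|\<close>. Double counting gives the first two moments of
  \<open>d\<^sub>T\<close>; in matrix terms \<open>A\<^sup>2 = q\<^sup>2 I + J\<close> for the adjacency matrix \<open>A\<close> of the polarity graph. For the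
  set of absolute points the variance of \<open>d\<^sub>T\<close> over the non-absolute points vanishes, so the polar of
  a non-absolute point carries exactly \<open>q + 1\<close> absolute points. The \<open>q\<^sup>2 - q\<close> other points are paired
  off into triangles with \<open>x\<close>, so in a triangle-free \<open>S\<close> every degree is at most \<open>(q\<^sup>2 - q) / 2\<close>.
  The Cauchy-Schwarz inequality for the function \<open>A 1\<^sub>S + q 1\<^sub>S\<close>, whose norm is controlled by these
  degrees (\<open>-q\<close> is the least eigenvalue of \<open>A\<close>), bounds \<open>|S|\<close>; equality forces it to be constant.
\<close>

section \<open>Moments of the degree function\<close>

lemma sum_diff_const_power2:
  fixes w :: "'a \<Rightarrow> real" and c :: real
  shows "(\<Sum>x\<in>A. (w x - c)\<^sup>2) = (\<Sum>x\<in>A. (w x)\<^sup>2) - 2 * c * (\<Sum>x\<in>A. w x) + card A * c\<^sup>2"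
proof -
  have "(\<Sum>x\<in>A. (w x - c)\<^sup>2) = (\<Sum>x\<in>A. (w x)\<^sup>2 - 2 * c * w x + c\<^sup>2)"
    by (intro sum.cong refl) (simp add: power2_eq_square algebra_simps)
  then show ?thesis
    by (simp add: sum.distrib sum_subtractf sum_distrib_left)
qed

text \<open>Keeps only the map from points to polars, read as neighbourhoods.
  \<open>card_polar\<close> and \<open>card_polar_Int\<close> are the diagonal and off-diagonal
  entries of A^2 = n I + J.\<close>

locale polar_map =
  fixes P :: "'p set" and polar :: "'p \<Rightarrow> 'p set" and n :: nat
  assumes finite_P: "finite P"
    and nonempty: "P \<noteq> {}"
    and polar_subset: "x \<in> P \<Longrightarrow> polar x \<subseteq> P"
    and polar_sym: "x \<in> P \<Longrightarrow> y \<in> polar x \<Longrightarrow> x \<in> polar y"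
    and card_polar: "x \<in> P \<Longrightarrow> card (polar x) = n + 1"
    and card_polar_Int: "x \<in> P \<Longrightarrow> y \<in> P \<Longrightarrow> x \<noteq> y \<Longrightarrow> card (polar x \<inter> polar y) = 1"
begin

lemma polar_commute: "x \<in> P \<Longrightarrow> y \<in> P \<Longrightarrow> x \<in> polar y \<longleftrightarrow> y \<in> polar x"
  using polar_sym by blast

lemma polar_Int_unique:
  assumes "x \<in> P" "y \<in> P" "x \<noteq> y" "z \<in> polar x" "z \<in> polar y" "z' \<in> polar x" "z' \<in> polar y"
  shows "z = z'"
proof -
  obtain u where "polar x \<inter> polar y = {u}"
    using card_polar_Int[OF assms(1-3)] by (auto simp: card_1_singleton_iff)
  then show ?thesis using assms(4-7) by (metis IntI singletonD)
qed

definition deg :: "'p set \<Rightarrow> 'p \<Rightarrow> real" where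
  "deg T x = real (card (polar x \<inter> T))"

lemma finite_polar: "x \<in> P \<Longrightarrow> finite (polar x)"
  using polar_subset finite_P finite_subset by blast

lemma deg_eq_sum:
  assumes "x \<in> P" "T \<subseteq> P"
  shows "deg T x = (\<Sum>y\<in>T. of_bool (x \<in> polar y))"
proof -
  have "finite T" using assms finite_P finite_subset by blast
  moreover have "polar x \<inter> T = T \<inter> {y. x \<in> polar y}"
    using assms polar_commute by blast
  ultimately show ?thesis unfolding deg_def by simp
qed

lemma sum_of_bool_polar: "y \<in> P \<Longrightarrow> (\<Sum>x\<in>P. of_bool (x \<in> polar y)) = (real n + 1)"
  using polar_subset[of y] finite_P card_polar[of y]
  by (simp add: Int_absorb1)

lemma sum_deg:
  assumes "T \<subseteq> P"
  shows "(\<Sum>x\<in>P. deg T x) = (real n + 1) * card T"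
proof -
  have "(\<Sum>x\<in>P. deg T x) = (\<Sum>x\<in>P. \<Sum>y\<in>T. of_bool (x \<in> polar y))"
    using assms by (intro sum.cong) (auto simp: deg_eq_sum)
  also have "\<dots> = (\<Sum>y\<in>T. \<Sum>x\<in>P. of_bool (x \<in> polar y))" by (rule sum.swap)
  also have "\<dots> = (\<Sum>y\<in>T. real n + 1)"
    using assms by (intro sum.cong sum_of_bool_polar) auto
  finally show ?thesis by simp
qed

text \<open>The square counts pairs from \<open>T\<close> lying on a common polar:
  \<open>n + 1\<close> polars contain a given point, exactly one contains two given distinct
  points.\<close>

lemma sum_deg_power2:
  assumes "T \<subseteq> P"
  shows "(\<Sum>x\<in>P. (deg T x)\<^sup>2) = real n * card T + (real (card T))\<^sup>2"
proof -
  have finT: "finite T" using assms finite_P finite_subset by blast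
  have pair: "(\<Sum>x\<in>P. of_bool (x \<in> polar y) * of_bool (x \<in> polar z)) = 1 + real n * of_bool (y = z)"
    if "y \<in> T" "z \<in> T" for y z
  proof (cases "y = z")
    case True
    then show ?thesis using sum_of_bool_polar[of y] that assms
      by (auto simp flip: of_bool_conj)
  next
    case False
    have "P \<inter> {x. x \<in> polar y \<and> x \<in> polar z} = polar y \<inter> polar z"
      using that assms polar_subset by blast
    then show ?thesis using False card_polar_Int[of y z] that assms finite_P
      by (auto simp flip: of_bool_conj)
  qed
  have "(\<Sum>x\<in>P. (deg T x)\<^sup>2) = (\<Sum>x\<in>P. \<Sum>y\<in>T. \<Sum>z\<in>T. of_bool (x \<in> polar y) * of_bool (x \<in> polar z))"
    using assms by (intro sum.cong refl) (simp only: deg_eq_sum power2_eq_square sum_product)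
  also have "\<dots> = (\<Sum>y\<in>T. \<Sum>x\<in>P. \<Sum>z\<in>T. of_bool (x \<in> polar y) * of_bool (x \<in> polar z))"
    by (rule sum.swap)
  also have "\<dots> = (\<Sum>y\<in>T. \<Sum>z\<in>T. \<Sum>x\<in>P. of_bool (x \<in> polar y) * of_bool (x \<in> polar z))"
    by (intro sum.cong refl sum.swap)
  also have "\<dots> = (\<Sum>y\<in>T. \<Sum>z\<in>T. 1 + real n * of_bool (y = z))"
    by (intro sum.cong refl pair)
  also have "\<dots> = (\<Sum>y\<in>T. card T + real n)"
    using finT by (intro sum.cong refl) (simp add: sum.distrib flip: sum_distrib_left)
  finally show ?thesis by (simp add: power2_eq_square algebra_simps)
qed

text \<open>For \<open>T = P\<close> every degree is \<open>n + 1\<close>, and the second moment can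
  be divided by \<open>card P\<close>.\<close>

lemma card_P: "real (card P) = (real n)\<^sup>2 + real n + 1"
proof -
  have "deg P x = real n + 1" if "x \<in> P" for x
    using that card_polar[of x] polar_subset[of x] by (simp add: deg_def Int_absorb2)
  then have "(\<Sum>x\<in>P. (deg P x)\<^sup>2) = card P * (real n + 1)\<^sup>2" by simp
  then have "real (card P) * (real n + 1)\<^sup>2 = real (card P) * (real n + card P)"
    using sum_deg_power2[of P] by (simp add: power2_eq_square algebra_simps)
  moreover have "card P \<noteq> 0" using finite_P nonempty by simp
  ultimately have "(real n + 1)\<^sup>2 = real n + card P" by simp
  then show ?thesis by (simp add: power2_eq_square algebra_simps)
qed

section \<open>Absolute points on polars\<close>

abbreviation Abs :: "'p set" where "Abs \<equiv> absolute_points P polar"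

lemma Abs_subset: "Abs \<subseteq> P"
  by (auto simp: absolute_points_def)

lemma Abs_iff: "x \<in> P \<Longrightarrow> x \<in> Abs \<longleftrightarrow> x \<in> polar x"
  by (simp add: absolute_points_def)

text \<open>With a second absolute point \<open>y\<close> on the polar of \<open>x\<close>, both
  \<open>x\<close> and \<open>y\<close> would lie on both polars, but polars of distinct points
  share one point only.\<close>

lemma deg_Abs_absolute:
  assumes "x \<in> Abs"
  shows "deg Abs x = 1"
proof -
  have x: "x \<in> P" "x \<in> polar x" using assms by (auto simp: absolute_points_def)
  have "y = x" if "y \<in> polar x" "y \<in> Abs" for y
  proof (rule ccontr)
    assume "y \<noteq> x"
    moreover have "y \<in> P" "y \<in> polar y" using that by (auto simp: absolute_points_def)
    ultimately show False
      using polar_Int_unique[of x y x y] x that polar_sym by blast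
  qed
  then have "polar x \<inter> Abs = {x}" using x assms by blast
  then show ?thesis by (simp add: deg_def)
qed

lemma deg_Abs_nonabsolute:
  assumes n: "n = q\<^sup>2" and card_Abs: "card Abs = q ^ 3 + 1" and x: "x \<in> P - Abs"
  shows "deg Abs x = real q + 1"
proof -
  let ?N = "P - Abs"
  have finN: "finite ?N" "finite Abs" using finite_P Abs_subset finite_subset by auto
  have split: "(\<Sum>y\<in>?N. f y) = (\<Sum>y\<in>P. f y) - (\<Sum>y\<in>Abs. f y)" for f :: "'p \<Rightarrow> real"
    using sum_diff[OF finite_P Abs_subset] .
  have a: "real (card Abs) = real q ^ 3 + 1" by (simp add: card_Abs)
  have s1: "(\<Sum>y\<in>?N. deg Abs y) = (real q ^ 3 + 1) * (real q)\<^sup>2"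
    using sum_deg[OF Abs_subset] by (simp add: split deg_Abs_absolute a n algebra_simps)
  have s2: "(\<Sum>y\<in>?N. (deg Abs y)\<^sup>2) = (real q ^ 3 + 1) * ((real q)\<^sup>2 + real q ^ 3)"
    using sum_deg_power2[OF Abs_subset]
    by (simp add: split deg_Abs_absolute a n algebra_simps power2_eq_square)
  have "real (card ?N) = real (card P) - real (card Abs)"
    using card_Diff_subset[OF finN(2) Abs_subset] card_mono[OF finite_P Abs_subset] by simp
  then have c: "real (card ?N) = (real q ^ 4 + (real q)\<^sup>2 - real q ^ 3)"
    by (simp add: card_P a n)
  \<comment> \<open>As q^3 + 1 = (q + 1)(q^2 - q + 1), the mean is q + 1, and the three terms of the
    expansion are q^2 (q + 1)(q^3 + 1) times 1, -2 and 1.\<close>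
  have "(\<Sum>y\<in>?N. (deg Abs y - (real q + 1))\<^sup>2) = 0"
    unfolding sum_diff_const_power2 s1 s2 c by algebra
  then show ?thesis using x finN by (simp add: sum_nonneg_eq_0_iff)
qed

section \<open>Degrees inside a triangle-free set\<close>

text \<open>
  On the non-absolute points of \<open>x\<^sup>\<bottom>\<close>, mapping \<open>y\<close> to the point \<open>x\<^sup>\<bottom> \<inter> y\<^sup>\<bottom>\<close> is a fixed-point free
  involution, and no orbit of it lies in \<open>S\<close>.
\<close>
lemma two_deg_le:
  assumes x: "x \<in> S" and S: "S \<subseteq> P - Abs"
    and tri: "\<And>y z. y \<in> S \<Longrightarrow> z \<in> S \<Longrightarrow> y \<in> polar x \<Longrightarrow> z \<in> polar x \<Longrightarrow> z \<in> polar y \<Longrightarrow> False"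
  shows "2 * card (polar x \<inter> S) \<le> card (polar x - Abs)"
proof -
  have xP: "x \<in> P" "x \<notin> polar x" using x S Abs_iff by auto
  let ?N = "polar x - Abs"
  have finN: "finite ?N" using finite_polar xP by simp
  have N: "y \<in> P" "y \<notin> polar y" "y \<noteq> x" "y \<in> polar x" if "y \<in> ?N" for y
    using that polar_subset xP Abs_iff by auto
  have "\<exists>z. z \<in> polar x \<inter> polar y" if "y \<in> ?N" for y
    using card_polar_Int[of x y] N[OF that] xP by (metis card_1_singletonE singletonI)
  then obtain f where f: "f y \<in> polar x" "f y \<in> polar y" if "y \<in> ?N" for y
    by (metis IntD1 IntD2)
  have fP: "f y \<in> P" "f y \<noteq> x" "f y \<noteq> y" "x \<in> polar (f y)" "y \<in> polar (f y)" if "y \<in> ?N" for y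
  proof -
    note fN = f[OF that] N[OF that]
    show "f y \<in> P" using fN(1) polar_subset xP by blast
    show "f y \<noteq> x" using fN(1) xP by metis
    show "f y \<noteq> y" using fN(2,4) by metis
    show "x \<in> polar (f y)" "y \<in> polar (f y)" using fN(1-3) xP polar_sym by simp_all
  qed
  have fN: "f y \<in> ?N" if y: "y \<in> ?N" for y
  proof -
    \<comment> \<open>Otherwise \<open>f y\<close> and \<open>y\<close> would both be the single
      common point of the polars of \<open>x\<close> and \<open>f y\<close>.\<close>
    have "f y \<notin> polar (f y)"
      using polar_Int_unique[of x "f y" "f y" y] f[OF y] fP[OF y] N[OF y] xP by metis
    then show ?thesis using f[OF y] fP[OF y] Abs_iff by blast
  qed
  have inj: "inj_on f ?N"
  proof (rule inj_onI)
    fix y y' assume "y \<in> ?N" "y' \<in> ?N" "f y = f y'"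
    then show "y = y'"
      using polar_Int_unique[of x "f y" y y'] fP N xP by metis
  qed
  have sub: "polar x \<inter> S \<subseteq> ?N" using S by blast
  \<comment> \<open>If \<open>y\<close> and \<open>f y\<close> both lay in \<open>S\<close>, they
    would form a triangle with \<open>x\<close>.\<close>
  have "(polar x \<inter> S) \<inter> f ` (polar x \<inter> S) = {}"
    using tri f sub by blast
  then have "card (polar x \<inter> S) + card (f ` (polar x \<inter> S)) = card ((polar x \<inter> S) \<union> f ` (polar x \<inter> S))"
    using finite_polar xP by (simp add: card_Un_disjoint)
  also have "\<dots> \<le> card ?N" using sub fN by (intro card_mono finN) blast
  finally show ?thesis using card_image[OF inj_on_subset[OF inj sub]] by simp
qed

section \<open>The variance bound on the size of the set\<close>

lemma card_bound:
  fixes q :: nat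
  defines "k \<equiv> ((real q)\<^sup>2 - real q) / 2"
  assumes n: "n = q\<^sup>2" and q: "q > 0" and S: "S \<subseteq> P"
    and degS: "\<And>x. x \<in> S \<Longrightarrow> deg S x \<le> k"
  shows "real (card S) \<le> (real q ^ 4 + real q) / 2"
    and "real (card S) = (real q ^ 4 + real q) / 2 \<Longrightarrow> x \<in> P \<Longrightarrow> deg S x \<in> {k, k + real q}"
proof -
  define Q where "Q = real q"
  define s where "s = real (card S)"
  define e where "e = (\<Sum>y\<in>S. deg S y)"
  define w where "w y = deg S y + Q * of_bool (y \<in> S)" for y
  \<comment> \<open>the mean of \<open>w\<close>, as \<open>q\<^sup>4 + q\<^sup>2 + 1 = (q\<^sup>2 + q + 1) (q\<^sup>2 - q + 1)\<close>\<close>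
  define c where "c = s / (Q\<^sup>2 - Q + 1)"
  have Q: "Q \<ge> 1" using q by (simp add: Q_def)
  then have m: "Q\<^sup>2 - Q + 1 > 0" using self_le_power[of Q 2] by simp
  have P: "real (card P) = (Q\<^sup>2 + Q + 1) * (Q\<^sup>2 - Q + 1)"
    unfolding card_P n of_nat_power Q_def by algebra
  have ind: "(\<Sum>y\<in>P. f y * of_bool (y \<in> S)) = (\<Sum>y\<in>S. f y)" for f :: "'p \<Rightarrow> real"
    using finite_P S by (simp add: Int_absorb1)
  have w1: "(\<Sum>y\<in>P. w y) = (Q\<^sup>2 + Q + 1) * s"
  proof -
    have "(\<Sum>y\<in>P. w y) = (Q\<^sup>2 + 1) * s + (\<Sum>y\<in>S. Q)"
      using sum_deg[OF S] by (simp only: w_def sum.distrib ind) (simp add: n Q_def s_def)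
    then show ?thesis by (simp add: s_def algebra_simps)
  qed
  \<comment> \<open>In matrix terms, (A + q I)^2 = 2 q^2 I + J + 2 q A.\<close>
  have w2: "(\<Sum>y\<in>P. (w y)\<^sup>2) = 2 * Q\<^sup>2 * s + s\<^sup>2 + 2 * Q * e"
  proof -
    have "(\<Sum>y\<in>P. (w y)\<^sup>2) = (\<Sum>y\<in>P. (deg S y)\<^sup>2 + (2 * Q * deg S y + Q\<^sup>2) * of_bool (y \<in> S))"
      by (intro sum.cong refl) (auto simp: w_def power2_eq_square algebra_simps)
    also have "\<dots> = (Q\<^sup>2 * s + s\<^sup>2) + (\<Sum>y\<in>S. 2 * Q * deg S y + Q\<^sup>2)"
      using sum_deg_power2[OF S] by (simp only: sum.distrib ind) (simp add: n Q_def s_def)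
    also have "(\<Sum>y\<in>S. 2 * Q * deg S y + Q\<^sup>2) = 2 * Q * e + s * Q\<^sup>2"
      by (simp add: sum.distrib e_def s_def sum_distrib_left)
    finally show ?thesis by (simp add: algebra_simps)
  qed
  have e: "e \<le> s * k" using sum_mono[of S "deg S" "\<lambda>_. k"] degS by (simp add: e_def s_def)
  have s: "s = c * (Q\<^sup>2 - Q + 1)" using m by (simp add: c_def)
  have "(\<Sum>y\<in>P. (w y - c)\<^sup>2) = 2 * Q\<^sup>2 * s + s\<^sup>2 + 2 * Q * e - (Q\<^sup>2 + Q + 1) * c * s"
    unfolding sum_diff_const_power2 w1 w2 P s by algebra
  \<comment> \<open>Writing one factor of s^2 as c (Q^2 - Q + 1) leaves -2 Q c s after subtracting
    (Q^2 + Q + 1) c s.\<close>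
  also have "\<dots> = 2 * Q * (s * (Q - c) + e)"
    unfolding s by algebra
  also have "\<dots> \<le> 2 * Q * (s * (Q - c) + s * k)"
    using e Q by simp
  also have "\<dots> = 2 * Q * s * (k + Q - c)" by algebra
  finally have var: "(\<Sum>y\<in>P. (w y - c)\<^sup>2) \<le> 2 * Q * s * (k + Q - c)" .
  \<comment> \<open>The claimed bound on \<open>s\<close> thus says \<open>c \<le> k + Q\<close>; a
    larger \<open>c\<close> would make the bound \<open>var\<close> on a sum of squares
    negative.\<close>
  have bound: "(Q ^ 4 + Q) / 2 = (k + Q) * (Q\<^sup>2 - Q + 1)"
    unfolding k_def Q_def[symmetric] by (simp add: field_simps) algebra
  have "c \<le> k + Q"
  proof (rule ccontr)
    assume "\<not> c \<le> k + Q"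
    have "k + Q = (Q\<^sup>2 + Q) / 2" by (simp add: k_def Q_def field_simps)
    also have "\<dots> \<ge> 0" using Q by simp
    finally have "k + Q \<ge> 0" .
    with \<open>\<not> c \<le> k + Q\<close> have "c > 0" "k + Q - c < 0" by auto
    then have "2 * Q * s * (k + Q - c) < 0"
      using s m Q by (intro mult_pos_neg) auto
    moreover have "(\<Sum>y\<in>P. (w y - c)\<^sup>2) \<ge> 0" by (intro sum_nonneg) auto
    ultimately show False using var by linarith
  qed
  then show "real (card S) \<le> (real q ^ 4 + real q) / 2"
    using m unfolding Q_def[symmetric] s_def[symmetric] bound s by simp
  assume "real (card S) = (real q ^ 4 + real q) / 2" and x: "x \<in> P"
  then have "c = k + Q"
    using m unfolding Q_def[symmetric] s_def[symmetric] bound s by simp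
  then have "(\<Sum>y\<in>P. (w y - c)\<^sup>2) = 0"
    using var sum_nonneg[of P "\<lambda>y. (w y - c)\<^sup>2"] by simp
  then have "w x = k + Q"
    using x finite_P \<open>c = k + Q\<close> by (simp add: sum_nonneg_eq_0_iff)
  \<comment> \<open>Constancy of \<open>w\<close> gives degree \<open>k\<close> on \<open>S\<close>
    and \<open>k + Q\<close> off \<open>S\<close>.\<close>
  then show "deg S x \<in> {k, k + real q}"
    by (cases "x \<in> S") (auto simp: w_def Q_def)
qed

end

section \<open>From the projective plane to the theorem\<close>

text \<open>In order 0 lines are singletons, yet two points of the quadrangle must be joined by a
  line.\<close>

lemma order_pos:
  assumes "projective_plane_of_order n P L"
  shows "n > 0"
proof (rule ccontr)
  assume "\<not> n > 0"
  with assms have line: "card l = 1" if "l \<in> L" for l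
    using that by (simp add: projective_plane_of_order_def)
  from assms obtain Q where Q: "Q \<subseteq> P" "card Q = 4"
    by (auto simp: projective_plane_of_order_def projective_plane_def)
  then have "\<not> card Q \<le> Suc 0" "finite Q" by (auto intro: card_ge_0_finite)
  then obtain x y where xy: "x \<in> Q" "y \<in> Q" "x \<noteq> y"
    by (auto simp: card_le_Suc0_iff_eq)
  moreover have "\<forall>x\<in>P. \<forall>y\<in>P. x \<noteq> y \<longrightarrow> (\<exists>!l. l \<in> L \<and> x \<in> l \<and> y \<in> l)"
    using assms by (simp add: projective_plane_of_order_def projective_plane_def)
  ultimately obtain l where "l \<in> L" "x \<in> l" "y \<in> l"
    using Q(1) by (meson subsetD)
  with xy line show False by (metis card_1_singletonE singletonD)
qed

text \<open>Symmetry is preservation of incidence applied to the line \<open>polar x\<close>, whose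
  pole is \<open>x\<close>; injectivity of \<open>polar\<close> makes two polars distinct lines,
  which meet in one point.\<close>

lemma polar_map_of_polarity:
  assumes plane: "projective_plane_of_order n P L" and pol: "polarity P L polar pole"
  shows "polar_map P polar n"
proof
  have L: "polar x \<in> L" if "x \<in> P" for x
    using pol that by (auto simp: polarity_def bij_betw_def)
  show "finite P" using plane by (simp add: projective_plane_of_order_def)
  show "P \<noteq> {}"
    using plane by (force simp: projective_plane_of_order_def projective_plane_def)
  show sub: "polar x \<subseteq> P" if "x \<in> P" for x
    using plane L[OF that] by (simp add: projective_plane_of_order_def projective_plane_def)
  show "x \<in> polar y" if "x \<in> P" "y \<in> polar x" for x y
  proof -
    have "y \<in> P" using sub that by blast
    then have "pole (polar x) \<in> polar y"
      using pol L that unfolding polarity_def by blast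
    then show ?thesis using pol that by (simp add: polarity_def)
  qed
  show "card (polar x) = n + 1" if "x \<in> P" for x
    using plane L[OF that] by (simp add: projective_plane_of_order_def)
  show "card (polar x \<inter> polar y) = 1" if xy: "x \<in> P" "y \<in> P" "x \<noteq> y" for x y
  proof -
    have "polar x \<noteq> polar y"
      using pol xy by (auto simp: polarity_def bij_betw_def inj_on_def)
    moreover have "\<forall>l\<in>L. \<forall>m\<in>L. l \<noteq> m \<longrightarrow> (\<exists>!z. z \<in> P \<and> z \<in> l \<and> z \<in> m)"
      using plane by (simp add: projective_plane_of_order_def projective_plane_def)
    ultimately have "\<exists>!z. z \<in> P \<and> z \<in> polar x \<and> z \<in> polar y"
      using L xy by simp
    then have "\<exists>z. polar x \<inter> polar y = {z}" using sub xy by blast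
    then show ?thesis by auto
  qed
qed

lemma is_triangle_induced:
  assumes "S \<subseteq> P" "x \<in> S" "y \<in> S" "z \<in> S" "x \<noteq> y" "x \<noteq> z" "y \<noteq> z"
    and "x \<in> polar y" "y \<in> polar x" "x \<in> polar z" "z \<in> polar x" "y \<in> polar z" "z \<in> polar y"
  shows "is_triangle (polarity_graph P polar \<restriction> S) {x, y, z}"
proof -
  have "u \<rightarrow>\<^bsub>polarity_graph P polar \<restriction> S\<^esub> v" if "u \<in> S" "v \<in> S" "u \<in> polar v" for u v
    using that assms(1)
    by (force simp: polarity_graph_def induce_subgraph_def arcs_ends_def arc_to_ends_def)
  moreover have "card {x, y, z} = 3" using assms(5-7) by simp
  ultimately show ?thesis
    using assms(2-4,8-) unfolding is_triangle_def by (auto simp: induce_subgraph_def)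
qed

theorem theorem1:
  fixes q :: nat and P S :: "'p set" and L :: "'p set set"
    and polar :: "'p \<Rightarrow> 'p set" and pole :: "'p set \<Rightarrow> 'p"
  assumes "projective_plane_of_order (q ^ 2) P L"
    and "unitary_polarity q P L polar pole"
    and "S \<subseteq> P - absolute_points P polar"
    and "\<nexists>T. is_triangle (polarity_graph P polar \<restriction> S) T"
  shows "real (card S) \<le> (real q ^ 4 + real q) / 2 \<and>
    (real (card S) = (real q ^ 4 + real q) / 2 \<longrightarrow>
      (\<forall>l\<in>L. real (card (l \<inter> S)) \<in> {(real q ^ 2 - real q) / 2, (real q ^ 2 + real q) / 2}))"
proof -
  from assms(2) have pol: "polarity P L polar pole"
    and card_Abs: "card (absolute_points P polar) = q ^ 3 + 1"
    by (simp_all add: unitary_polarity_def)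
  interpret polar_map P polar "q\<^sup>2"
    using assms(1) pol by (rule polar_map_of_polarity)
  have q: "q > 0" using order_pos[OF assms(1)] by simp
  have SP: "S \<subseteq> P" using assms(3) by blast
  have deg_le: "deg S x \<le> ((real q)\<^sup>2 - real q) / 2" if x: "x \<in> S" for x
  proof -
    have xP: "x \<in> P - Abs" using x assms(3) by blast
    have nonabs: "y \<notin> polar y" if "y \<in> S" for y
      using that assms(3) Abs_iff by blast
    have "2 * card (polar x \<inter> S) \<le> card (polar x - Abs)"
    proof (rule two_deg_le[OF x assms(3)])
      fix y z assume yz: "y \<in> S" "z \<in> S" "y \<in> polar x" "z \<in> polar x" "z \<in> polar y"
      \<comment> \<open>A coincidence would put a point of \<open>S\<close> on its own
        polar.\<close>
      then have "x \<noteq> y" "x \<noteq> z" "y \<noteq> z" using nonabs x by blast+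
      moreover have "x \<in> polar y" "x \<in> polar z" "y \<in> polar z"
        using yz x SP polar_sym by blast+
      ultimately show False
        using is_triangle_induced[OF SP x yz(1,2)] yz assms(4) by blast
    qed
    moreover have "real (card (polar x - Abs)) = real (card (polar x)) - deg Abs x"
      using finite_polar xP card_Int_Diff[of "polar x" Abs] by (simp add: deg_def)
    \<comment> \<open>Of the q^2 + 1 points on the polar, q + 1 are absolute.\<close>
    moreover have "\<dots> = (real q)\<^sup>2 - real q"
      using deg_Abs_nonabsolute[OF refl card_Abs xP] card_polar xP by simp
    ultimately show ?thesis by (simp add: deg_def)
  qed
  note bound = card_bound[OF refl q SP deg_le]
  show ?thesis
  proof (intro conjI impI ballI)
    show "real (card S) \<le> (real q ^ 4 + real q) / 2" by (rule bound(1))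
    fix l assume eq: "real (card S) = (real q ^ 4 + real q) / 2" and "l \<in> L"
    \<comment> \<open>Every line is a polar, so its intersection with \<open>S\<close> is counted by
      a degree.\<close>
    then obtain x where x: "x \<in> P" "l = polar x"
      using pol by (auto simp: polarity_def bij_betw_def)
    have "((real q)\<^sup>2 - real q) / 2 + real q = ((real q)\<^sup>2 + real q) / 2"
      by (simp add: field_simps)
    then show "real (card (l \<inter> S)) \<in> {(real q ^ 2 - real q) / 2, (real q ^ 2 + real q) / 2}"
      using bound(2)[OF _ eq x(1)] x(2) by (simp only: deg_def)
  qed
qed

end
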